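(* Let $(X,d)$ be a complete metric space (with $X$ nonempty) and let $T: X\to X$ be a polynomial contraction, i.e. there exist $\lambda\in(0,1)$, a natural number $k\ge 1$ and mappings $a_i: X\times X\to[0,\infty)$, $i=0,\dots,k$, such that $$\sum_{i=0}^k a_i(Tx,Ty)\,d^i(Tx,Ty)\le \lambda\sum_{i=0}^k a_i(x,y)\,d^i(x,y)\qquad\text{for all }x,y\in X.$$ Assume that: (i) $T$ is continuous; (ii) there exist $j\in\{1,\dots,k\}$ and $A_j>0$ such that $a_j(x,y)\ge A_j$ for all $x,y\in X$. Then $T$ admits a unique fixed point $z^*\in X$. Moreover, for every $z_0\in X$, the Picard sequence $\{z_n\}\subset X$ defined by $z_{n+1}=Tz_n$ for all $n\ge 0$ converges to $z^*$.
   Context: Here $Tx$ denotes $T(x)$ and $d^i(x,y)=(d(x,y))^i$ is the $i$-th power of the distance, with $d^0(x,y)=1$ for all $x,y\in X$ (including $x=y$), so the $i=0$ terms are $a_0(Tx,Ty)$ and $a_0(x,y)$. *)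

theory Defs
  imports "HOL-Analysis.Analysis"
begin

text \<open>
  The parameters \<open>lam\<close>, \<open>k\<close>, \<open>a\<close> witnessing that \<open>T\<close> is a polynomial contraction are arguments of
  the predicate, because later hypotheses refer to the coefficient functions \<open>a i\<close>.
  Only the values of \<open>a i\<close> on \<open>X\<close> for \<open>i \<le> k\<close> matter. The power \<open>d x y ^ 0\<close> is 1 also for \<open>x = y\<close>.
\<close>

definition polynomial_contraction_wrt ::
  "'a set \<Rightarrow> ('a \<Rightarrow> 'a \<Rightarrow> real) \<Rightarrow> real \<Rightarrow> nat \<Rightarrow> (nat \<Rightarrow> 'a \<Rightarrow> 'a \<Rightarrow> real) \<Rightarrow> ('a \<Rightarrow> 'a) \<Rightarrow> bool"
  where
  "polynomial_contraction_wrt X d lam k a T \<longleftrightarrow>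
     T \<in> X \<rightarrow> X \<and> 0 < lam \<and> lam < 1 \<and> k \<ge> 1 \<and>
     (\<forall>i\<le>k. \<forall>x\<in>X. \<forall>y\<in>X. a i x y \<ge> 0) \<and>
     (\<forall>x\<in>X. \<forall>y\<in>X.
        (\<Sum>i=0..k. a i (T x) (T y) * d (T x) (T y) ^ i)
          \<le> lam * (\<Sum>i=0..k. a i x y * d x y ^ i))"

end

theory Submission
  imports Defs
begin

text \<open>
  Write \<open>P x y\<close> for the polynomial expression \<open>\<Sum>i\<le>k. a i x y * d x y ^ i\<close>. The contraction
  hypothesis says that \<open>P\<close> shrinks by the factor \<open>lam\<close> whenever \<open>T\<close> is applied to both
  arguments, so it decays like \<open>lam ^ n\<close> along any pair of orbits. All summands of \<open>P\<close> are
  nonnegative and one of them, with positive exponent \<open>j\<close>, is at least \<open>A * d x y ^ j\<close>. Taking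
  \<open>j\<close>-th roots, the distance between the \<open>n\<close>-th iterates of any two points is at most a constant
  times \<open>root j lam ^ n\<close> (\<open>polynomial_contraction_wrt_orbits_approach\<close>).

  Both halves of the theorem are instances of this one estimate. Applied to \<open>x\<close> and \<open>T x\<close>, it
  bounds consecutive steps of an orbit geometrically, so orbits are Cauchy and converge
  (\<open>Metric_space.MCauchy_if_geometric_steps\<close>); continuity makes the limit a fixed point. Applied to
  two fixed points, which do not move, it forces their distance to be \<open>0\<close>. Hence the limits of all
  orbits coincide.
\<close>

lemma (in Metric_space) MCauchy_if_geometric_steps:
  assumes ran: "range z \<subseteq> M"
    and step: "\<And>n. d (z n) (z (Suc n)) \<le> C * q ^ n"
    and q: "0 \<le> q" "q < 1"
  shows "MCauchy z"
proof -
  have zM [simp]: "z n \<in> M" for n using ran by auto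
  \<comment> \<open>The bound is the sum of the whole geometric series from \<open>m\<close> on. It does not depend on \<open>p\<close>,
    and splitting off the first step reproduces it exactly, so the induction closes.\<close>
  have tail: "d (z m) (z (m + p)) \<le> C * q ^ m / (1 - q)" for m p
  proof (induction p arbitrary: m)
    case 0
    have "0 \<le> C * q ^ m" using step[of m] nonneg order_trans by blast
    then show ?case using q by simp
  next
    case (Suc p)
    have "d (z m) (z (m + Suc p)) \<le> d (z m) (z (Suc m)) + d (z (Suc m)) (z (Suc m + p))"
      using triangle[of "z m" "z (Suc m)" "z (Suc m + p)"] by simp
    also have "\<dots> \<le> C * q ^ m + C * q ^ Suc m / (1 - q)"
      using step[of m] Suc.IH[of "Suc m"] by linarith
    also have "\<dots> = C * q ^ m / (1 - q)"
      using q by (simp add: field_simps)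
    finally show ?case .
  qed
  have lim: "(\<lambda>m. C * q ^ m / (1 - q)) \<longlonglongrightarrow> 0"
    using q by (auto intro!: tendsto_eq_intros LIMSEQ_power_zero)
  show ?thesis
    unfolding MCauchy_def
  proof (intro conjI allI impI ran)
    fix e :: real
    assume "e > 0"
    with lim obtain N where N: "\<And>m. m \<ge> N \<Longrightarrow> C * q ^ m / (1 - q) < e"
      by (metis eventually_sequentially order_tendstoD(2))
    have ordered: "d (z m) (z n) < e" if "N \<le> m" "m \<le> n" for m n
      using tail[of m "n - m"] N[of m] that by simp
    have "d (z m) (z n) < e" if "N \<le> m" "N \<le> n" for m n
      using ordered[of m n] ordered[of n m] that commute[of "z m" "z n"]
      by (cases m n rule: le_cases) auto
    then show "\<exists>N. \<forall>n n'. N \<le> n \<longrightarrow> N \<le> n' \<longrightarrow> d (z n) (z n') < e" by blast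
  qed
qed

text \<open>
  Only one monomial needs a uniform lower bound: the others are nonnegative and can be discarded
  after the decay of the whole sum has been established. The exponent must be positive, since the
  constant monomial carries no information about the distance.
\<close>

lemma polynomial_contraction_wrt_orbits_approach:
  assumes "Metric_space X d"
    and pc: "polynomial_contraction_wrt X d lam k a T"
    and j: "j \<in> {1..k}" and A: "A > 0" "\<And>x y. x \<in> X \<Longrightarrow> y \<in> X \<Longrightarrow> a j x y \<ge> A"
    and xy: "x \<in> X" "y \<in> X"
  shows "\<exists>C. \<forall>n. d ((T ^^ n) x) ((T ^^ n) y) \<le> C * root j lam ^ n"
proof -
  interpret Metric_space X d by fact
  define P where "P u v = (\<Sum>i=0..k. a i u v * d u v ^ i)" for u v
  have TX: "T u \<in> X" if "u \<in> X" for u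
    using pc that unfolding polynomial_contraction_wrt_def by auto
  have lam: "0 < lam" using pc by (simp add: polynomial_contraction_wrt_def)
  have orbit: "(T ^^ n) u \<in> X" if "u \<in> X" for n u
    using that by (induction n) (auto intro: TX)
  have decay: "P ((T ^^ n) x) ((T ^^ n) y) \<le> lam ^ n * P x y" for n
  proof (induction n)
    case (Suc n)
    have "P ((T ^^ Suc n) x) ((T ^^ Suc n) y) \<le> lam * P ((T ^^ n) x) ((T ^^ n) y)"
      using pc orbit xy by (simp add: polynomial_contraction_wrt_def P_def)
    also have "\<dots> \<le> lam * (lam ^ n * P x y)"
      using Suc.IH lam by (intro mult_left_mono) auto
    finally show ?case by (simp add: mult.assoc)
  qed simp
  have lower: "A * d u v ^ j \<le> P u v" if "u \<in> X" "v \<in> X" for u v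
  proof -
    have "A * d u v ^ j \<le> a j u v * d u v ^ j"
      using A(2) that by (intro mult_right_mono) auto
    also have "\<dots> \<le> P u v"
      unfolding P_def
      using j pc that by (intro member_le_sum) (auto simp: polynomial_contraction_wrt_def)
    finally show ?thesis .
  qed
  have "d ((T ^^ n) x) ((T ^^ n) y) \<le> root j (P x y / A) * root j lam ^ n" for n
  proof -
    let ?D = "d ((T ^^ n) x) ((T ^^ n) y)"
    have "A * ?D ^ j \<le> lam ^ n * P x y"
      using lower decay orbit xy order_trans by blast
    then have "?D ^ j \<le> P x y / A * lam ^ n"
      using A(1) by (simp add: field_simps)
    then have "root j (?D ^ j) \<le> root j (P x y / A * lam ^ n)"
      using j by (intro real_root_le_mono) auto
    then show ?thesis
      using j lam by (simp add: real_root_power_cancel real_root_mult real_root_divide real_root_power)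
  qed
  then show ?thesis by blast
qed

theorem theorem2p2:
  fixes X :: "'a set" and d :: "'a \<Rightarrow> 'a \<Rightarrow> real" and T :: "'a \<Rightarrow> 'a"
    and lam :: real and k :: nat and a :: "nat \<Rightarrow> 'a \<Rightarrow> 'a \<Rightarrow> real"
  assumes "Metric_space X d"
    and "Metric_space.mcomplete X d"
    and "X \<noteq> {}"
    and "polynomial_contraction_wrt X d lam k a T"
    and "continuous_map (Metric_space.mtopology X d) (Metric_space.mtopology X d) T"
    and "\<exists>j\<in>{1..k}. \<exists>A>0. \<forall>x\<in>X. \<forall>y\<in>X. a j x y \<ge> A"
  shows "\<exists>zs\<in>X. T zs = zs \<and> (\<forall>w\<in>X. T w = w \<longrightarrow> w = zs) \<and>
           (\<forall>z :: nat \<Rightarrow> 'a. z 0 \<in> X \<longrightarrow> (\<forall>n. z (Suc n) = T (z n)) \<longrightarrow>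
              limitin (Metric_space.mtopology X d) z zs sequentially)"
proof -
  interpret Metric_space X d by fact
  obtain j A where j: "j \<in> {1..k}" and A: "A > 0" "\<And>x y. x \<in> X \<Longrightarrow> y \<in> X \<Longrightarrow> a j x y \<ge> A"
    using assms(6) by blast
  define q where "q = root j lam"
  have TX: "T x \<in> X" if "x \<in> X" for x
    using assms(4) that by (auto simp: polynomial_contraction_wrt_def)
  have q: "0 \<le> q" "q < 1"
    using j assms(4) by (auto simp: q_def polynomial_contraction_wrt_def)
  have approach: "\<exists>C. \<forall>n. d ((T ^^ n) x) ((T ^^ n) y) \<le> C * q ^ n" if "x \<in> X" "y \<in> X" for x y
    unfolding q_def
    by (rule polynomial_contraction_wrt_orbits_approach[OF assms(1,4) j A that])
  have orbit: "z = (\<lambda>n. (T ^^ n) (z 0))" if "\<forall>n. z (Suc n) = T (z n)" for z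
  proof
    show "z n = (T ^^ n) (z 0)" for n by (induction n) (simp_all add: that)
  qed
  have orbit_in: "(T ^^ n) x \<in> X" if "x \<in> X" for n x
    using that by (induction n) (auto intro: TX)
  have fixed_unique: "w = v" if wv: "w \<in> X" "v \<in> X" "T w = w" "T v = v" for w v
  proof -
    have stay: "(T ^^ n) w = w" "(T ^^ n) v = v" for n
      using wv by (induction n) auto
    obtain C where "\<And>n. d w v \<le> C * q ^ n"
      using approach[OF wv(1,2)] stay by auto
    moreover have "(\<lambda>n. C * q ^ n) \<longlonglongrightarrow> 0"
      using q by (auto intro!: tendsto_eq_intros LIMSEQ_power_zero)
    ultimately have "d w v \<le> 0"
      by (meson LIMSEQ_le_const)
    then show "w = v" using wv nonneg[of w v] zero[of w v] by auto
  qed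
  have converges: "\<exists>l\<in>X. T l = l \<and> limitin mtopology (\<lambda>n. (T ^^ n) x) l sequentially"
    if x: "x \<in> X" for x
  proof -
    let ?z = "\<lambda>n. (T ^^ n) x"
    obtain C where C: "\<And>n. d (?z n) ((T ^^ n) (T x)) \<le> C * q ^ n"
      using approach[OF x TX[OF x]] by blast
    have "MCauchy ?z"
      by (rule MCauchy_if_geometric_steps[where C = C and q = q])
        (use C q orbit_in x in \<open>auto simp: funpow_swap1\<close>)
    then obtain l where l: "limitin mtopology ?z l sequentially"
      using assms(2) mcomplete_def by blast
    then have lX: "l \<in> X" using limitin_mspace by blast
    have "limitin mtopology (T \<circ> ?z) (T l) sequentially"
      using continuous_map_limit[OF assms(5) l] .
    moreover have "limitin mtopology (T \<circ> ?z) l sequentially"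
      using limitin_sequentially_offset[OF l, of 1] by (simp add: comp_def)
    ultimately have "T l = l"
      using limitin_metric_unique trivial_limit_sequentially by blast
    with l lX show ?thesis by blast
  qed
  obtain x where "x \<in> X" using assms(3) by blast
  then obtain zs where zs: "zs \<in> X" "T zs = zs" using converges by blast
  have "limitin mtopology z zs sequentially"
    if "z 0 \<in> X" "\<forall>n. z (Suc n) = T (z n)" for z
    using converges[OF that(1)] fixed_unique zs orbit[OF that(2)] by metis
  with zs fixed_unique show ?thesis by blast
qed

end
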